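(* Let $\{K_s: s\in\mathbb{N}^{<\omega}\}$ be a family of compact subsets of $[0,1]^{\mathcal{N}}$ such that $d_{\mathcal{N}_s}$ fragments $K_s$ for every $s\in\mathbb{N}^{<\omega}$. For every $s\in\mathbb{N}^{<\omega}$ of length $n$ let $$[K_s]=\left\{x\in[0,1]^{\mathcal{N}}:\exists y\in K_s\ \ d_{\mathcal{N}_s}(x,y)\leq\tfrac{1}{2^n}\right\},$$ and let $L_s\subset[K_s]$ be a compact set. Then $K=\bigcap_{s\in\mathbb{N}^{<\omega}}L_s$ is a continuous image of an RN compactum.
   Context: Compact spaces are Hausdorff; products of intervals carry the product topology. $\mathcal{N}=\mathbb{N}^{\mathbb{N}}$ is the set of infinite sequences of natural numbers ($0\in\mathbb{N}$), $\mathbb{N}^{<\omega}$ is the set of finite sequences of natural numbers, and for $s\in\mathbb{N}^{<\omega}$, $\mathcal{N}_s$ is the set of $\sigma\in\mathcal{N}$ having $s$ as an initial segment. In $[0,1]^{\mathcal{N}}$ the index set $\mathcal{N}$ is regarded as a plain set. For $\Delta\subset\mathcal{N}$ and $x,y\in[0,1]^{\mathcal{N}}$, $d_\Delta(x,y)=\sup\{|x_\gamma-y_\gamma|:\gamma\in\Delta\}$. A map $d:K\times K\to\mathbb{R}$ on a topological space $K$ $\varepsilon$-fragments $K$ if every nonempty closed set $L\subset K$ has a nonempty relatively open subset $U$ with $\sup\{d(x,y):x,y\in U\}<\varepsilon$; $d$ fragments $K$ if it $\varepsilon$-fragments $K$ for every $\varepsilon>0$. A compact space $K$ is RN (Radon-Nikodým)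 compact if there is a lower semicontinuous metric $d:K\times K\to\mathbb{R}$ which fragments $K$ (equivalently, $K$ is homeomorphic to a weak$^*$ compact subset of a dual Banach space with the Radon-Nikodým property; equivalently, $K$ embeds in some $[-1,1]^{\Gamma'}$ so that the uniform metric $d_{\Gamma'}(x,y)=\sup_{\gamma\in\Gamma'}|x_\gamma-y_\gamma|$ fragments $K$). *)

theory Defs
  imports "HOL-Analysis.Analysis"
begin

text \<open>The Baire space \<open>\<nat>\<^sup>\<nat>\<close> is the type \<^typ>\<open>nat \<Rightarrow> nat\<close>; finite sequences are of type \<^typ>\<open>nat list\<close>.\<close>

definition cylinder :: "nat list \<Rightarrow> (nat \<Rightarrow> nat) set" where
  "cylinder s = {\<sigma>. \<forall>i < length s. \<sigma> i = s ! i}"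

definition cube :: "((nat \<Rightarrow> nat) \<Rightarrow> real) topology" where
  "cube = product_topology (\<lambda>_. top_of_set {0..1}) UNIV"

text \<open>For real-valued \<^const>\<open>Sup\<close> this is meaningful when \<open>\<Delta>\<close> is nonempty and the differences
  are bounded, as is always the case for cylinders and for points of the cube.\<close>

definition unif_dist :: "'i set \<Rightarrow> ('i \<Rightarrow> real) \<Rightarrow> ('i \<Rightarrow> real) \<Rightarrow> real" where
  "unif_dist \<Delta> x y = (SUP \<gamma>\<in>\<Delta>. \<bar>x \<gamma> - y \<gamma>\<bar>)"

text \<open>The diameter is taken in \<^typ>\<open>ereal\<close>: an unbounded set has infinite diameter, whereas its
  supremum in \<^typ>\<open>real\<close> would be unspecified.\<close>

definition eps_fragments :: "real \<Rightarrow> 'a topology \<Rightarrow> ('a \<Rightarrow> 'a \<Rightarrow> real) \<Rightarrow> bool" where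
  "eps_fragments \<epsilon> X d \<longleftrightarrow>
     (\<forall>L. closedin X L \<and> L \<noteq> {} \<longrightarrow>
        (\<exists>U. openin (subtopology X L) U \<and> U \<noteq> {} \<and>
             (SUP (x, y)\<in>U \<times> U. ereal (d x y)) < ereal \<epsilon>))"

definition fragments :: "'a topology \<Rightarrow> ('a \<Rightarrow> 'a \<Rightarrow> real) \<Rightarrow> bool" where
  "fragments X d \<longleftrightarrow> (\<forall>\<epsilon>>0. eps_fragments \<epsilon> X d)"

definition lower_semicontinuous_map :: "'a topology \<Rightarrow> ('a \<Rightarrow> real) \<Rightarrow> bool" where
  "lower_semicontinuous_map X f \<longleftrightarrow> (\<forall>a. openin X {x \<in> topspace X. a < f x})"

definition RN_compact :: "'a topology \<Rightarrow> bool" where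
  "RN_compact X \<longleftrightarrow>
     compact_space X \<and> Hausdorff_space X \<and>
     (\<exists>d. Metric_space (topspace X) d \<and>
          lower_semicontinuous_map (prod_topology X X) (\<lambda>(x, y). d x y) \<and>
          fragments X d)"

definition bracket :: "nat list \<Rightarrow> ((nat \<Rightarrow> nat) \<Rightarrow> real) set \<Rightarrow> ((nat \<Rightarrow> nat) \<Rightarrow> real) set" where
  "bracket s A =
     {x \<in> topspace cube. \<exists>y\<in>A. unif_dist (cylinder s) x y \<le> 1 / 2 ^ length s}"

end

(* R consists of the families y with y s in K_s (cut off to zero outside the cylinder N_s) for which
   some x in K satisfies |x_gamma - (y s)_gamma| <= 2^-|s| for all s and all gamma in N_s. Since
   every gamma lies in cylinders of arbitrarily long s, y determines x; the pairs (x, y) form a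
   compact set, so y |-> x is continuous, and it is onto because L_s is contained in [K_s]. The
   weighted supremum of the uniform distances of the blocks y s is a lower semicontinuous metric
   on R; the cut-off is what makes it separate points, and it fragments R. *)
theory Submission
  imports Defs
begin

section \<open>Fragmentability: pullbacks, images and finite families of distances\<close>

lemma fragmentsD:
  assumes "fragments X d" "0 < \<epsilon>" "closedin X L" "L \<noteq> {}"
  obtains U where "openin (subtopology X L) U" "U \<noteq> {}" "\<And>x y. x \<in> U \<Longrightarrow> y \<in> U \<Longrightarrow> d x y < \<epsilon>"
proof -
  obtain U where U: "openin (subtopology X L) U" "U \<noteq> {}"
      "(SUP (x, y)\<in>U \<times> U. ereal (d x y)) < ereal \<epsilon>"
    using assms unfolding fragments_def eps_fragments_def by blast
  have "d x y < \<epsilon>" if "x \<in> U" "y \<in> U" for x y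
  proof -
    have "ereal (d x y) \<le> (SUP (x, y)\<in>U \<times> U. ereal (d x y))"
      using that by (intro SUP_upper2[of "(x, y)"]) auto
    with U(3) show ?thesis
      by (metis ereal_less_eq(3) not_le order.trans)
  qed
  with U that show ?thesis by blast
qed

lemma fragmentsI:
  assumes "\<And>\<epsilon> L. 0 < \<epsilon> \<Longrightarrow> closedin X L \<Longrightarrow> L \<noteq> {} \<Longrightarrow>
    \<exists>U. openin (subtopology X L) U \<and> U \<noteq> {} \<and> (\<forall>x\<in>U. \<forall>y\<in>U. d x y \<le> \<epsilon>)"
  shows "fragments X d"
  unfolding fragments_def eps_fragments_def
proof (intro allI impI, elim conjE)
  fix \<epsilon> :: real and L
  assume *: "0 < \<epsilon>" "closedin X L" "L \<noteq> {}"
  obtain U where U: "openin (subtopology X L) U" "U \<noteq> {}" "\<forall>x\<in>U. \<forall>y\<in>U. d x y \<le> \<epsilon> / 2"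
    using assms[of "\<epsilon> / 2" L] * by auto
  have "(SUP (x, y)\<in>U \<times> U. ereal (d x y)) \<le> ereal (\<epsilon> / 2)"
    using U(3) by (intro SUP_least) auto
  also have "\<dots> < ereal \<epsilon>"
    using * by simp
  finally show "\<exists>U. openin (subtopology X L) U \<and> U \<noteq> {} \<and>
      (SUP (x, y)\<in>U \<times> U. ereal (d x y)) < ereal \<epsilon>"
    using U by blast
qed

lemma fragments_pullback:
  assumes X: "compact_space X" and Y: "Hausdorff_space Y" and g: "continuous_map X Y g"
    and d: "fragments Y d"
  shows "fragments X (\<lambda>x y. d (g x) (g y))"
proof (rule fragmentsI)
  fix \<epsilon> :: real and L
  assume "0 < \<epsilon>" and L: "closedin X L" "L \<noteq> {}"
  have "closedin Y (g ` L)"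
    using continuous_imp_closed_map[OF g X Y] L by (simp add: closed_map_def)
  moreover have "g ` L \<noteq> {}"
    using L by simp
  ultimately obtain V where V: "openin (subtopology Y (g ` L)) V" "V \<noteq> {}"
      "\<And>x y. x \<in> V \<Longrightarrow> y \<in> V \<Longrightarrow> d x y < \<epsilon>"
    by (rule fragmentsD[OF d \<open>0 < \<epsilon>\<close>]) blast
  then obtain W where W: "openin Y W" "V = W \<inter> g ` L"
    by (auto simp: openin_subtopology)
  have "L \<subseteq> topspace X"
    using L closedin_subset by blast
  then have "L \<inter> {x \<in> topspace X. g x \<in> W} = {x \<in> L. g x \<in> W}"
    by blast
  moreover have "openin (subtopology X L) (L \<inter> {x \<in> topspace X. g x \<in> W})"
    using W openin_continuous_map_preimage[OF g] openin_subtopology_Int2 by blast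
  ultimately have "openin (subtopology X L) {x \<in> L. g x \<in> W}"
    by simp
  moreover have "{x \<in> L. g x \<in> W} \<noteq> {}"
    using V W by blast
  ultimately show "\<exists>U. openin (subtopology X L) U \<and> U \<noteq> {} \<and>
      (\<forall>x\<in>U. \<forall>y\<in>U. d (g x) (g y) \<le> \<epsilon>)"
    using V(3) W(2) by (intro exI[of _ "{x \<in> L. g x \<in> W}"]) (auto simp: less_imp_le)
qed

text \<open>Fragmentability passes to images because a nonempty open subset \<open>U\<close> of a minimal \<open>L\<close> has
  \<open>M - f ` (L - U)\<close> nonempty: this is a relatively open subset of \<open>M\<close> inside \<open>f ` U\<close>.\<close>

lemma minimal_closed_preimage:
  assumes X: "compact_space X" and Y: "t1_space Y" and f: "continuous_map X Y f"
    and M: "M \<subseteq> f ` topspace X" "closedin Y M"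
  obtains L where "closedin X L" "f ` L = M"
    "\<And>L'. closedin X L' \<Longrightarrow> f ` L' = M \<Longrightarrow> L' \<subseteq> L \<Longrightarrow> L' = L"
proof -
  \<comment> \<open>Zorn's lemma is run on complements: a member of \<open>\<A>\<close> is an open
    set whose complement still covers \<open>M\<close>, so a maximal member has a minimal
    complement.\<close>
  define \<A> where "\<A> = {A. openin X A \<and> M \<subseteq> f ` (topspace X - A)}"
  have "\<exists>A\<in>\<A>. \<forall>B\<in>\<A>. A \<subseteq> B \<longrightarrow> B = A"
  proof (rule subset_Zorn_nonempty)
    have "{} \<in> \<A>"
      using M by (auto simp: \<A>_def)
    then show "\<A> \<noteq> {}"
      by blast
  next
    fix \<C>
    assume ne: "\<C> \<noteq> {}" and ch: "subset.chain \<A> \<C>"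
    then have sub: "\<C> \<subseteq> \<A>"
      by (simp add: subset_chain_def)
    have op: "openin X (\<Union>\<C>)"
      using sub by (intro openin_Union) (auto simp: \<A>_def)
    have "y \<in> f ` (topspace X - \<Union>\<C>)" if y: "y \<in> M" for y
    proof (rule ccontr)
      assume no: "y \<notin> f ` (topspace X - \<Union>\<C>)"
      \<comment> \<open>If \<open>y\<close> lost all its preimages, its fibre, compact because
        closed in \<open>X\<close>, would be covered by the chain, hence by finitely many members
        and so by a single one. That member would not be in \<open>\<A>\<close>.\<close>
      define F where "F = {x \<in> topspace X. f x \<in> {y}}"
      have "closedin Y {y}"
        using Y y M closedin_subset by (fastforce simp: t1_space_closedin_singleton)
      then have "closedin X F"
        unfolding F_def by (rule closedin_continuous_map_preimage[OF f])
      then have "compactin X F"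
        using X closedin_compact_space by blast
      moreover have "F \<subseteq> \<Union>\<C>"
        using no by (auto simp: F_def)
      moreover have "\<forall>C\<in>\<C>. openin X C"
        using sub by (auto simp: \<A>_def)
      ultimately obtain \<F> where \<F>: "finite \<F>" "\<F> \<subseteq> \<C>" "F \<subseteq> \<Union>\<F>"
        unfolding compactin_def by meson
      have "F \<noteq> {}"
        using y M(1) by (auto simp: F_def)
      then have "\<F> \<noteq> {}"
        using \<F>(3) by auto
      moreover have "subset.chain \<A> \<F>"
        using ch \<F>(2) sub by (simp add: subset_chain_def subset_iff)
      ultimately have "\<Union>\<F> \<in> \<F>"
        by (rule Union_in_chain[OF \<F>(1)])
      then have "\<Union>\<F> \<in> \<A>"
        using \<F>(2) sub by blast
      then obtain x where "x \<in> topspace X - \<Union>\<F>" "f x = y"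
        using y by (auto simp: \<A>_def)
      then show False
        using \<F>(3) by (auto simp: F_def)
    qed
    then show "\<Union>\<C> \<in> \<A>"
      using op by (auto simp: \<A>_def)
  qed
  then obtain A where A: "A \<in> \<A>" "\<And>B. B \<in> \<A> \<Longrightarrow> A \<subseteq> B \<Longrightarrow> B = A"
    by blast
  \<comment> \<open>The complement of \<open>A\<close> may have values outside \<open>M\<close>;
    restricting to the preimage of \<open>M\<close> makes the image exactly
    \<open>M\<close>.\<close>
  define L where "L = {x \<in> topspace X. f x \<in> M} \<inter> (topspace X - A)"
  have cl: "closedin X L"
    unfolding L_def using A(1) M(2)
    by (intro closedin_Int closedin_continuous_map_preimage[OF f] closedin_diff) (auto simp: \<A>_def)
  show ?thesis
  proof (rule that[OF cl])
    show "f ` L = M"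
      using A(1) by (auto simp: L_def \<A>_def)
    fix L'
    assume L': "closedin X L'" "f ` L' = M" "L' \<subseteq> L"
    then have "L' \<subseteq> topspace X"
      by (simp add: closedin_subset)
    \<comment> \<open>By maximality of \<open>A\<close> this complement equals \<open>A\<close>, so
      \<open>L'\<close> is all of \<open>topspace X - A\<close> and contains
      \<open>L\<close>.\<close>
    then have "topspace X - L' \<in> \<A>"
      using L'(1,2) by (simp add: \<A>_def double_diff openin_diff)
    moreover have "A \<subseteq> topspace X - L'"
      using A(1) L'(3) openin_subset by (fastforce simp: \<A>_def L_def)
    ultimately have "topspace X - L' = A"
      by (rule A(2))
    then show "L' = L"
      using L'(2,3) \<open>L' \<subseteq> topspace X\<close> unfolding L_def by blast
  qed
qed

lemma fragments_image:
  assumes X: "compact_space X" and Y: "Hausdorff_space Y" and f: "continuous_map X Y f"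
    and surj: "f ` topspace X = topspace Y"
    and d: "fragments X (\<lambda>x y. d (f x) (f y))"
  shows "fragments Y d"
proof (rule fragmentsI)
  fix \<epsilon> :: real and M
  assume "0 < \<epsilon>" and M: "closedin Y M" "M \<noteq> {}"
  have "M \<subseteq> f ` topspace X"
    using closedin_subset[OF M(1)] surj by simp
  then obtain L where L: "closedin X L" "f ` L = M"
      and min: "\<And>L'. closedin X L' \<Longrightarrow> f ` L' = M \<Longrightarrow> L' \<subseteq> L \<Longrightarrow> L' = L"
    using M(1) by (rule minimal_closed_preimage[OF X Hausdorff_imp_t1_space[OF Y] f]) blast
  have "L \<noteq> {}"
    using L(2) M(2) by blast
  then obtain U where U: "openin (subtopology X L) U" "U \<noteq> {}"
      "\<And>x y. x \<in> U \<Longrightarrow> y \<in> U \<Longrightarrow> d (f x) (f y) < \<epsilon>"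
    by (rule fragmentsD[OF d \<open>0 < \<epsilon>\<close> L(1)]) blast
  have UL: "U \<subseteq> L"
    using U(1) openin_imp_subset by blast
  have "closedin (subtopology X L) (L - U)"
    using closedin_diff[OF closedin_topspace U(1)] L(1) closedin_subset
    by (metis inf.absorb_iff2 topspace_subtopology)
  then have cl: "closedin X (L - U)"
    using L(1) closedin_trans_full by blast
  have "closedin Y (f ` (L - U))"
    using continuous_imp_closed_map[OF f X Y] cl by (simp add: closed_map_def)
  then have "openin (subtopology Y M) (M \<inter> (topspace Y - f ` (L - U)))"
    by (intro openin_subtopology_Int2 openin_diff) auto
  moreover have "M \<inter> (topspace Y - f ` (L - U)) = M - f ` (L - U)"
    using closedin_subset[OF M(1)] by blast
  ultimately have op: "openin (subtopology Y M) (M - f ` (L - U))"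
    by simp
  \<comment> \<open>\<open>L - U\<close> is closed and strictly smaller than \<open>L\<close>, so
    minimality prevents it from mapping onto \<open>M\<close>.\<close>
  have "f ` (L - U) \<noteq> M"
    using min[OF cl] U(2) UL by blast
  then have ne: "M - f ` (L - U) \<noteq> {}"
    using L(2) by blast
  have small: "d x y \<le> \<epsilon>" if xy: "x \<in> M - f ` (L - U)" "y \<in> M - f ` (L - U)" for x y
  proof -
    have "x \<in> f ` U" "y \<in> f ` U"
      using xy L(2) by auto
    then obtain u v where "u \<in> U" "v \<in> U" "x = f u" "y = f v"
      by auto
    then show ?thesis
      using U(3)[of u v] by simp
  qed
  show "\<exists>V. openin (subtopology Y M) V \<and> V \<noteq> {} \<and> (\<forall>x\<in>V. \<forall>y\<in>V. d x y \<le> \<epsilon>)"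
    by (intro exI[of _ "M - f ` (L - U)"] conjI ballI op ne small)
qed

text \<open>The distances are treated one after another. The set \<open>U\<close> found so far need
  not be closed, so the next distance is applied to its closure and the resulting piece is cut back
  to \<open>U\<close>.\<close>

lemma fragments_finite_family:
  assumes "finite F" and d: "\<And>i. i \<in> F \<Longrightarrow> fragments X (d i)"
    and "0 < \<epsilon>" and L: "closedin X L" "L \<noteq> {}"
  shows "\<exists>U. openin (subtopology X L) U \<and> U \<noteq> {} \<and> (\<forall>i\<in>F. \<forall>x\<in>U. \<forall>y\<in>U. d i x y < \<epsilon>)"
  using assms(1,2)
proof (induction F rule: finite_induct)
  case empty
  have "openin (subtopology X L) L"
    using closedin_subset[OF L(1)] by (metis inf.absorb_iff2 openin_topspace topspace_subtopology)
  with L show ?case by blast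
next
  case (insert i F)
  then obtain U where U: "openin (subtopology X L) U" "U \<noteq> {}"
      "\<forall>j\<in>F. \<forall>x\<in>U. \<forall>y\<in>U. d j x y < \<epsilon>"
    by auto
  have UX: "U \<subseteq> topspace X" "U \<subseteq> L"
    using openin_subset[OF U(1)] by auto
  have sub: "U \<subseteq> X closure_of U"
    using closure_of_subset UX by blast
  have clL: "X closure_of U \<subseteq> L"
    using UX L closure_of_minimal by blast
  obtain V where V: "openin (subtopology X (X closure_of U)) V" "V \<noteq> {}"
      "\<And>x y. x \<in> V \<Longrightarrow> y \<in> V \<Longrightarrow> d i x y < \<epsilon>"
  proof (rule fragmentsD[OF insert.prems[of i] \<open>0 < \<epsilon>\<close>])
    show "X closure_of U \<noteq> {}"
      using sub U(2) by blast
  qed auto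
  obtain W where W: "openin X W" "V = W \<inter> X closure_of U"
    using V(1) by (auto simp: openin_subtopology)
  \<comment> \<open>An open set meeting the closure of \<open>U\<close> meets \<open>U\<close>
    itself, so cutting back leaves something.\<close>
  have "W \<inter> U \<noteq> {}"
    using openin_Int_closure_of_eq_empty[OF W(1), of U] V(2) W(2) by blast
  moreover have "openin (subtopology X L) (W \<inter> U)"
  proof -
    obtain T where "openin X T" "U = T \<inter> L"
      using U(1) by (auto simp: openin_subtopology)
    then show ?thesis
      using W(1) by (auto simp: openin_subtopology Int_assoc intro!: exI[of _ "W \<inter> T"])
  qed
  moreover have "\<forall>j\<in>insert i F. \<forall>x\<in>W \<inter> U. \<forall>y\<in>W \<inter> U. d j x y < \<epsilon>"
    using U(3) V(3) W(2) sub by auto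
  ultimately show ?case by blast
qed

section \<open>A criterion for RN compactness with countably many blocks of coordinates\<close>

lemma unif_dist_upper:
  assumes "\<And>\<gamma>. \<gamma> \<in> \<Delta> \<Longrightarrow> x \<gamma> \<in> {0..1}" "\<And>\<gamma>. \<gamma> \<in> \<Delta> \<Longrightarrow> y \<gamma> \<in> {0..1}" "\<gamma> \<in> \<Delta>"
  shows "\<bar>x \<gamma> - y \<gamma>\<bar> \<le> unif_dist \<Delta> x y"
  unfolding unif_dist_def
proof (rule cSUP_upper[OF assms(3)], rule bdd_aboveI2)
  show "\<bar>x \<gamma> - y \<gamma>\<bar> \<le> 1" if "\<gamma> \<in> \<Delta>" for \<gamma>
    using assms(1,2)[OF that] by auto
qed

text \<open>The weights leave only finitely many blocks of coordinates relevant at a given scale, so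
  fragmentability reduces to that of finitely many of the block distances. The absolute value in
  the definition of \<open>d\<close> guards against junk suprema outside \<open>topspace X\<close>, where a metric still has
  to be nonnegative.\<close>

lemma RN_compact_countable_product:
  fixes X :: "('i :: countable \<Rightarrow> 'j \<Rightarrow> real) topology"
  assumes X: "compact_space X" "Hausdorff_space X"
    and coord: "\<And>i j. continuous_map X (top_of_set {0..1}) (\<lambda>x. x i j)"
    and frag: "\<And>i. fragments X (\<lambda>x y. unif_dist UNIV (x i) (y i))"
  shows "RN_compact X"
proof -
  define w :: "'i \<Rightarrow> real" where "w = (\<lambda>i. (1 / 2) ^ to_nat i)"
  have w: "0 < w i" "w i \<le> 1" for i
    by (auto simp: w_def power_le_one)
  \<comment> \<open>One supremum over all pairs \<open>(i, j)\<close>, rather than a weighted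
    supremum of \<open>unif_dist\<close> values, presents \<open>d\<close> on \<open>X\<close> as a
    supremum of continuous functions.\<close>
  define t where "t = (\<lambda>(x :: 'i \<Rightarrow> 'j \<Rightarrow> real) y (i, j). w i * \<bar>x i j - y i j\<bar>)"
  define d where "d = (\<lambda>x y. \<bar>SUP p. t x y p\<bar>)"
  have range: "x i j \<in> {0..1}" if "x \<in> topspace X" for x i j
    using continuous_map_funspace[OF coord[of i j]] that by auto
  have t_bound: "0 \<le> t x y (i, j)" "t x y (i, j) \<le> w i" "t x y (i, j) \<le> \<bar>x i j - y i j\<bar>"
    if "x \<in> topspace X" "y \<in> topspace X" for x y i j
  proof -
    have "\<bar>x i j - y i j\<bar> \<le> 1"
      using range[of x i j] range[of y i j] that by auto
    then show "0 \<le> t x y (i, j)" "t x y (i, j) \<le> w i" "t x y (i, j) \<le> \<bar>x i j - y i j\<bar>"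
      using w[of i] by (auto simp: t_def mult_left_le mult_left_le_one_le)
  qed
  have SUP_upper: "t x y p \<le> (SUP p. t x y p)" if "x \<in> topspace X" "y \<in> topspace X" for x y p
  proof (rule cSUP_upper[OF UNIV_I], rule bdd_aboveI2)
    show "t x y p \<le> 1" for p
      using order_trans[OF t_bound(2)[OF that] w(2)] by (cases p) simp
  qed
  have d_upper: "t x y p \<le> d x y" if "x \<in> topspace X" "y \<in> topspace X" for x y p
    using SUP_upper[OF that, of p] unfolding d_def by linarith
  \<comment> \<open>On \<open>topspace X\<close> the terms are nonnegative, so the absolute value in
    \<open>d\<close> has no effect and a bound on all terms bounds \<open>d\<close>.\<close>
  have d_least: "d x y \<le> c"
    if "x \<in> topspace X" "y \<in> topspace X" "\<And>i j. t x y (i, j) \<le> c" for x y c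
  proof -
    have "0 \<le> (SUP p. t x y p)"
      using SUP_upper[OF that(1,2)] t_bound(1)[OF that(1,2)] by (metis order_trans surj_pair)
    moreover have "(SUP p. t x y p) \<le> c"
      using that(3) by (intro cSUP_least) auto
    ultimately show ?thesis
      by (simp add: d_def)
  qed
  have "Metric_space (topspace X) d"
  proof
    show "0 \<le> d x y" "d x y = d y x" for x y
      by (auto simp: d_def t_def abs_minus_commute)
    fix x y
    assume xy: "x \<in> topspace X" "y \<in> topspace X"
    show "d x y = 0 \<longleftrightarrow> x = y"
    proof
      assume "d x y = 0"
      then have "t x y (i, j) = 0" for i j
        using d_upper[OF xy, of "(i, j)"] t_bound(1)[OF xy, of i j] by linarith
      then have "w i * \<bar>x i j - y i j\<bar> = 0" for i j
        by (simp add: t_def)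
      then have "x i j = y i j" for i j
        using w(1)[of i] by (metis abs_eq_0 eq_iff_diff_eq_0 less_irrefl mult_eq_0_iff)
      then show "x = y"
        by (intro ext)
    qed (simp add: d_def t_def case_prod_unfold)
    fix z
    assume z: "z \<in> topspace X"
    show "d x z \<le> d x y + d y z"
    proof (rule d_least[OF xy(1) z])
      fix i j
      have "t x z (i, j) \<le> t x y (i, j) + t y z (i, j)"
        using w(1)[of i] by (simp add: t_def flip: distrib_left)
      also have "\<dots> \<le> d x y + d y z"
        by (intro add_mono d_upper xy z)
      finally show "t x z (i, j) \<le> d x y + d y z" .
    qed
  qed
  \<comment> \<open>A supremum exceeds \<open>a\<close> exactly when some term does, so the
    superlevel set is a union of open sets, one for each pair \<open>(i, j)\<close>.\<close>
  moreover have "lower_semicontinuous_map (prod_topology X X) (\<lambda>(x, y). d x y)"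
    unfolding lower_semicontinuous_map_def
  proof
    fix a
    let ?V = "\<lambda>i j. {q \<in> topspace (prod_topology X X). t (fst q) (snd q) (i, j) \<in> {a<..}}"
    have "continuous_map (prod_topology X X) euclideanreal (\<lambda>q. t (fst q) (snd q) (i, j))" for i j
    proof -
      have "continuous_map X euclideanreal (\<lambda>x. x i j)"
        using coord[of i j] by (simp add: continuous_map_in_subtopology)
      then have "continuous_map (prod_topology X X) euclideanreal (\<lambda>q. fst q i j)"
          "continuous_map (prod_topology X X) euclideanreal (\<lambda>q. snd q i j)"
        using continuous_map_compose[OF continuous_map_fst]
          continuous_map_compose[OF continuous_map_snd] by (fastforce simp: o_def)+
      then show ?thesis
        unfolding t_def by (auto intro!: continuous_intros)
    qed
    then have V: "openin (prod_topology X X) (?V i j)" for i j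
      by (rule openin_continuous_map_preimage) simp
    show "openin (prod_topology X X) {q \<in> topspace (prod_topology X X). a < (case q of (x, y) \<Rightarrow> d x y)}"
    proof -
      have "a < d x y \<longleftrightarrow> (\<exists>i j. a < t x y (i, j))" if "x \<in> topspace X" "y \<in> topspace X" for x y
      proof
        assume "a < d x y"
        then show "\<exists>i j. a < t x y (i, j)"
          using d_least[OF that, of a] by (meson not_le)
      next
        assume "\<exists>i j. a < t x y (i, j)"
        then obtain i j where "a < t x y (i, j)"
          by blast
        with d_upper[OF that, of "(i, j)"] show "a < d x y"
          by linarith
      qed
      then have "{q \<in> topspace (prod_topology X X). a < (case q of (x, y) \<Rightarrow> d x y)} = (\<Union>i j. ?V i j)"
        by (simp add: set_eq_iff split_beta) blast
      moreover have "openin (prod_topology X X) (\<Union>i j. ?V i j)"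
        using V by (intro openin_Union ballI) auto
      ultimately show ?thesis
        by simp
    qed
  qed
  moreover have "fragments X d"
  proof (rule fragmentsI)
    fix \<epsilon> :: real and L
    assume "0 < \<epsilon>" and L: "closedin X L" "L \<noteq> {}"
    \<comment> \<open>Coordinate differences are at most 1, so blocks of index at least
      \<open>n\<close> contribute at most \<open>(1 / 2) ^ n\<close> on any set. Only the finitely
      many blocks in \<open>F\<close> have to be made small by fragmentation.\<close>
    obtain n where n: "(1 / 2) ^ n < \<epsilon>"
      using real_arch_pow_inv[OF \<open>0 < \<epsilon>\<close>, of "1 / 2"] by auto
    define F :: "'i set" where "F = {i. to_nat i < n}"
    have "finite F"
      using finite_imageD[of to_nat F] finite_subset[of "to_nat ` F" "{..<n}"]
      by (auto simp: F_def inj_on_def)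
    then have "\<exists>U. openin (subtopology X L) U \<and> U \<noteq> {} \<and>
        (\<forall>i\<in>F. \<forall>x\<in>U. \<forall>y\<in>U. unif_dist UNIV (x i) (y i) < \<epsilon>)"
      using \<open>0 < \<epsilon>\<close> L
      by (intro fragments_finite_family[where d = "\<lambda>i x y. unif_dist UNIV (x i) (y i)"] frag)
    then obtain U where U: "openin (subtopology X L) U" "U \<noteq> {}"
        "\<forall>i\<in>F. \<forall>x\<in>U. \<forall>y\<in>U. unif_dist UNIV (x i) (y i) < \<epsilon>"
      by blast
    have small: "d x y \<le> \<epsilon>" if xy: "x \<in> U" "y \<in> U" for x y
    proof -
      have top: "x \<in> topspace X" "y \<in> topspace X"
        using openin_subset[OF U(1)] xy by auto
      show ?thesis
      proof (rule d_least[OF top])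
        fix i j
        show "t x y (i, j) \<le> \<epsilon>"
        proof (cases "i \<in> F")
          case True
          have "\<bar>x i j - y i j\<bar> \<le> unif_dist UNIV (x i) (y i)"
            using range top by (intro unif_dist_upper) auto
          then show ?thesis
            using t_bound(3)[OF top, of i j] U(3) True xy by force
        next
          case False
          then have "w i \<le> (1 / 2) ^ n"
            unfolding w_def F_def by (intro power_decreasing) auto
          then show ?thesis
            using t_bound(2)[OF top, of i j] n by linarith
        qed
      qed
    qed
    show "\<exists>U. openin (subtopology X L) U \<and> U \<noteq> {} \<and> (\<forall>x\<in>U. \<forall>y\<in>U. d x y \<le> \<epsilon>)"
      by (intro exI[of _ U] conjI ballI U(1,2) small)
  qed
  ultimately show ?thesis
    using X unfolding RN_compact_def by blast
qed

section \<open>The cube and the truncation of its points to a set of coordinates\<close>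

lemma topspace_cube: "topspace cube = {x. \<forall>\<gamma>. x \<gamma> \<in> {0..1}}"
  by (simp add: cube_def PiE_UNIV_domain Pi_def)

lemma compact_space_cube: "compact_space cube"
  by (simp add: cube_def compact_space_product_topology compact_space_subtopology)

lemma Hausdorff_space_cube: "Hausdorff_space cube"
  unfolding cube_def Hausdorff_space_product_topology
  by (intro disjI2 ballI Hausdorff_space_subtopology Hausdorff_space_euclidean)

lemma continuous_map_cube_coordinate: "continuous_map cube (top_of_set {0..1}) (\<lambda>x. x \<gamma>)"
  unfolding cube_def by (rule continuous_map_product_coordinates) simp

lemma continuous_map_cube_coordinate_real: "continuous_map cube euclideanreal (\<lambda>x. x \<gamma>)"
  by (rule continuous_map_into_fulltopology[OF continuous_map_cube_coordinate])

text \<open>Plays the part of the restriction to \<open>\<Delta>\<close> while keeping all points in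
  one cube. On truncated points the distance over \<open>\<Delta>\<close>, in general only a
  pseudometric, separates points.\<close>

definition zero_outside :: "'i set \<Rightarrow> ('i \<Rightarrow> real) \<Rightarrow> 'i \<Rightarrow> real" where
  "zero_outside \<Delta> x = (\<lambda>\<gamma>. if \<gamma> \<in> \<Delta> then x \<gamma> else 0)"

lemma continuous_map_zero_outside: "continuous_map cube cube (zero_outside \<Delta>)"
proof -
  have "continuous_map cube (top_of_set {0..1}) (\<lambda>x. zero_outside \<Delta> x \<gamma>)" for \<gamma>
    using continuous_map_cube_coordinate[of \<gamma>] by (cases "\<gamma> \<in> \<Delta>") (auto simp: zero_outside_def)
  then show ?thesis
    by (subst (2) cube_def) (simp add: continuous_map_componentwise_UNIV)
qed

text \<open>Coordinates outside \<open>\<Delta>\<close> contribute 0, which cannot exceed a supremum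
  of absolute values over a nonempty \<open>\<Delta>\<close>.\<close>

lemma unif_dist_zero_outside:
  assumes "x \<in> topspace cube" "y \<in> topspace cube" "\<Delta> \<noteq> {}"
  shows "unif_dist UNIV (zero_outside \<Delta> x) (zero_outside \<Delta> y) = unif_dist \<Delta> x y"
proof (rule antisym)
  have up: "\<bar>x \<gamma> - y \<gamma>\<bar> \<le> unif_dist \<Delta> x y" if "\<gamma> \<in> \<Delta>" for \<gamma>
    using assms that by (intro unif_dist_upper) (auto simp: topspace_cube)
  have "0 \<le> unif_dist \<Delta> x y"
    using up assms(3) by (meson abs_ge_zero equals0I order_trans)
  with up show "unif_dist UNIV (zero_outside \<Delta> x) (zero_outside \<Delta> y) \<le> unif_dist \<Delta> x y"
    by (subst unif_dist_def) (auto intro!: cSUP_least simp: zero_outside_def)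
  have "\<bar>zero_outside \<Delta> x \<gamma> - zero_outside \<Delta> y \<gamma>\<bar>
      \<le> unif_dist UNIV (zero_outside \<Delta> x) (zero_outside \<Delta> y)" for \<gamma>
    using assms by (intro unif_dist_upper) (auto simp: topspace_cube zero_outside_def)
  then have "\<bar>x \<gamma> - y \<gamma>\<bar> \<le> unif_dist UNIV (zero_outside \<Delta> x) (zero_outside \<Delta> y)" if "\<gamma> \<in> \<Delta>" for \<gamma>
    using that by (metis zero_outside_def)
  then show "unif_dist \<Delta> x y \<le> unif_dist UNIV (zero_outside \<Delta> x) (zero_outside \<Delta> y)"
    by (subst unif_dist_def) (intro cSUP_least assms(3))
qed

lemma fragments_cong:
  assumes "\<And>x y. x \<in> topspace X \<Longrightarrow> y \<in> topspace X \<Longrightarrow> d x y = d' x y" "fragments X d"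
  shows "fragments X d'"
proof (rule fragmentsI)
  fix \<epsilon> :: real and L
  assume "0 < \<epsilon>" "closedin X L" "L \<noteq> {}"
  then obtain U where U: "openin (subtopology X L) U" "U \<noteq> {}"
      "\<And>x y. x \<in> U \<Longrightarrow> y \<in> U \<Longrightarrow> d x y < \<epsilon>"
    by (rule fragmentsD[OF assms(2)]) blast
  moreover have "U \<subseteq> topspace X"
    using openin_subset[OF U(1)] by simp
  ultimately show "\<exists>U. openin (subtopology X L) U \<and> U \<noteq> {} \<and> (\<forall>x\<in>U. \<forall>y\<in>U. d' x y \<le> \<epsilon>)"
    using assms(1) by (intro exI[of _ U]) (auto simp: subset_iff less_imp_le)
qed

text \<open>The distance over \<open>\<Delta>\<close> on \<open>K\<close> is the pullback of the
  full uniform distance along the truncation, so \<open>fragments_image\<close> transfers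
  fragmentability to the truncated set.\<close>

lemma fragments_zero_outside:
  assumes K: "compactin cube K" and frag: "fragments (subtopology cube K) (unif_dist \<Delta>)"
    and "\<Delta> \<noteq> {}"
  shows "fragments (subtopology cube (zero_outside \<Delta> ` K)) (unif_dist UNIV)"
proof (rule fragments_image)
  have sub: "K \<subseteq> topspace cube" "zero_outside \<Delta> ` K \<subseteq> topspace cube"
    using K image_compactin[OF K continuous_map_zero_outside] compactin_subset_topspace by blast+
  show "compact_space (subtopology cube K)"
    using K by (rule compact_space_subtopology)
  show "Hausdorff_space (subtopology cube (zero_outside \<Delta> ` K))"
    by (intro Hausdorff_space_subtopology Hausdorff_space_cube)
  show "continuous_map (subtopology cube K) (subtopology cube (zero_outside \<Delta> ` K)) (zero_outside \<Delta>)"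
    by (auto simp: continuous_map_in_subtopology continuous_map_from_subtopology continuous_map_zero_outside)
  show "zero_outside \<Delta> ` topspace (subtopology cube K)
      = topspace (subtopology cube (zero_outside \<Delta> ` K))"
    using sub by (simp add: Int_absorb1)
  show "fragments (subtopology cube K)
      (\<lambda>x y. unif_dist UNIV (zero_outside \<Delta> x) (zero_outside \<Delta> y))"
    using frag by (rule fragments_cong[rotated]) (simp add: unif_dist_zero_outside assms(3))
qed

section \<open>Cylinders, the space of approximating families and the map onto the
  intersection\<close>

lemma cylinder_map_upt: "\<gamma> \<in> cylinder (map \<gamma> [0..<n])"
  by (simp add: cylinder_def)

lemma cylinder_nonempty: "cylinder s \<noteq> {}"
proof -
  have "(\<lambda>i. s ! i) \<in> cylinder s"
    by (simp add: cylinder_def)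
  then show ?thesis
    by blast
qed

theorem mainTheorem3:
  fixes K L :: "nat list \<Rightarrow> ((nat \<Rightarrow> nat) \<Rightarrow> real) set"
  assumes "\<And>s. compactin cube (K s)"
    and "\<And>s. fragments (subtopology cube (K s)) (unif_dist (cylinder s))"
    and "\<And>s. L s \<subseteq> bracket s (K s)"
    and "\<And>s. compactin cube (L s)"
  shows "\<exists>(R :: (nat list \<Rightarrow> (nat \<Rightarrow> nat) \<Rightarrow> real) topology) f.
           RN_compact R \<and>
           continuous_map R (subtopology cube (\<Inter>s. L s)) f \<and>
           f ` topspace R = (\<Inter>s. L s)"
proof -
  let ?K = "\<lambda>s. zero_outside (cylinder s) ` K s"
  define T :: "(nat list \<Rightarrow> (nat \<Rightarrow> nat) \<Rightarrow> real) topology"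
    where "T = product_topology (\<lambda>_. cube) UNIV"
  define P where "P = prod_topology cube T"
  \<comment> \<open>Closeness is stated coordinate by coordinate, not through
    \<open>unif_dist\<close>, so that \<open>Z\<close> is visibly an intersection of preimages of
    closed sets under continuous maps.\<close>
  define Z where "Z = {(x, y). x \<in> (\<Inter>s. L s) \<and> (\<forall>s. y s \<in> ?K s) \<and>
    (\<forall>s. \<forall>\<gamma>\<in>cylinder s. \<bar>x \<gamma> - y s \<gamma>\<bar> \<le> 1 / 2 ^ length s)}"
  define R where "R = subtopology T (snd ` Z)"
  have KT: "?K s \<subseteq> topspace cube" "closedin cube (?K s)" for s
    using image_compactin[OF assms(1) continuous_map_zero_outside]
      compactin_imp_closedin[OF Hausdorff_space_cube] compactin_subset_topspace by blast+
  have LT: "L s \<subseteq> topspace cube" "closedin cube (L s)" for s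
    using assms(4) compactin_imp_closedin[OF Hausdorff_space_cube] compactin_subset_topspace
    by blast+
  have T: "compact_space T" "Hausdorff_space T"
    by (simp_all add: T_def compact_space_product_topology compact_space_cube
        Hausdorff_space_product_topology Hausdorff_space_cube)
  have coordT: "continuous_map T cube (\<lambda>y. y s)" for s
    unfolding T_def by (rule continuous_map_product_coordinates) simp
  have fst: "continuous_map P cube fst" and snd: "continuous_map P T snd"
    unfolding P_def by (rule continuous_map_fst continuous_map_snd)+
  have coordP: "continuous_map P cube (\<lambda>p. snd p s)" for s
    using continuous_map_compose[OF snd coordT] by (simp add: o_def)
  have P: "compact_space P"
    using T compact_space_cube by (simp add: P_def compact_space_prod_topology)
  have ZP: "Z \<subseteq> topspace P"
  proof (clarsimp simp: Z_def P_def T_def PiE_UNIV_domain Pi_iff, intro conjI allI)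
    fix x and y :: "nat list \<Rightarrow> (nat \<Rightarrow> nat) \<Rightarrow> real"
    assume "\<forall>s. x \<in> L s"
    then show "x \<in> topspace cube"
      using LT(1) by blast
    fix s
    assume "\<forall>s. y s \<in> ?K s"
    then show "y s \<in> topspace cube"
      using KT(1) by blast
  qed
  have "closedin P Z"
  proof -
    let ?A = "\<lambda>s. {p \<in> topspace P. fst p \<in> L s}"
    let ?B = "\<lambda>s. {p \<in> topspace P. snd p s \<in> ?K s}"
    let ?C = "\<lambda>s \<gamma>. {p \<in> topspace P. \<bar>fst p \<gamma> - snd p s \<gamma>\<bar> \<in> {..1 / 2 ^ length s}}"
    have "closedin P (?A s)" "closedin P (?B s)" for s
      using closedin_continuous_map_preimage[OF fst LT(2)]
        closedin_continuous_map_preimage[OF coordP KT(2)] by auto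
    moreover have "closedin P (?C s \<gamma>)" for s \<gamma>
    proof (rule closedin_continuous_map_preimage)
      have "continuous_map P euclideanreal (\<lambda>p. fst p \<gamma>)"
          "continuous_map P euclideanreal (\<lambda>p. snd p s \<gamma>)"
        using continuous_map_compose[OF fst continuous_map_cube_coordinate_real[of \<gamma>]]
          continuous_map_compose[OF coordP[of s] continuous_map_cube_coordinate_real[of \<gamma>]]
        by (simp_all add: o_def)
      then show "continuous_map P euclideanreal (\<lambda>p. \<bar>fst p \<gamma> - snd p s \<gamma>\<bar>)"
        by (intro continuous_intros)
      show "closedin euclideanreal {..1 / 2 ^ length s}"
        by simp
    qed
    moreover have "Z = (\<Inter>s. ?A s \<inter> ?B s \<inter> (\<Inter>\<gamma>\<in>cylinder s. ?C s \<gamma>))"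
    proof -
      have "Z = topspace P \<inter> Z"
        using ZP by blast
      also have "\<dots> = (\<Inter>s. ?A s \<inter> ?B s \<inter> (\<Inter>\<gamma>\<in>cylinder s. ?C s \<gamma>))"
        using cylinder_nonempty by (auto simp: Z_def)
      finally show ?thesis .
    qed
    ultimately show ?thesis
      \<comment> \<open>An intersection over an empty index set would be the whole type rather than
        a closed set; nonempty cylinders exclude this.\<close>
      using cylinder_nonempty by (simp add: closedin_INT closedin_Int)
  qed
  then have Z: "compactin P Z"
    using P closedin_compact_space by blast
  have R: "compact_space R" "Hausdorff_space R"
    unfolding R_def using image_compactin[OF Z snd] T(2)
    by (simp_all add: compact_space_subtopology Hausdorff_space_subtopology)
  have topR: "topspace R = snd ` Z"
    using ZP by (auto simp: R_def P_def)
  have "RN_compact R"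
  \<comment> \<open>The blocks are indexed by finite sequences, which form a countable type.\<close>
  proof (rule RN_compact_countable_product[OF R])
    have coordR: "continuous_map R cube (\<lambda>y. y s)" for s
      unfolding R_def by (rule continuous_map_from_subtopology[OF coordT])
    show "continuous_map R (top_of_set {0..1}) (\<lambda>y. y s \<gamma>)" for s \<gamma>
      using continuous_map_compose[OF coordR continuous_map_cube_coordinate] by (simp add: o_def)
    show "fragments R (\<lambda>x y. unif_dist UNIV (x s) (y s))" for s
    proof (rule fragments_pullback[OF R(1), where g = "\<lambda>y. y s" and d = "unif_dist UNIV"])
      show "Hausdorff_space (subtopology cube (?K s))"
        by (intro Hausdorff_space_subtopology Hausdorff_space_cube)
      show "continuous_map R (subtopology cube (?K s)) (\<lambda>y. y s)"
        using coordR topR by (auto simp: continuous_map_in_subtopology Z_def)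
      show "fragments (subtopology cube (?K s)) (unif_dist UNIV)"
        using assms(1,2) cylinder_nonempty by (rule fragments_zero_outside)
    qed
  qed
  have inj: "inj_on snd Z"
  proof (rule inj_onI, clarsimp)
    fix x x' y
    assume xx': "(x, y) \<in> Z" "(x', y) \<in> Z"
    have "x \<gamma> = x' \<gamma>" for \<gamma>
    proof (rule ccontr)
      assume "x \<gamma> \<noteq> x' \<gamma>"
      \<comment> \<open>The division by 2 leaves room for two errors of size
        \<open>(1 / 2) ^ n\<close>, one from \<open>x\<close> and one from \<open>x'\<close>, both
        measured against the same block \<open>?s\<close>, the first \<open>n\<close> values of
        \<open>\<gamma>\<close>.\<close>
      then obtain n where n: "(1 / 2) ^ n < \<bar>x \<gamma> - x' \<gamma>\<bar> / 2"
        using real_arch_pow_inv[of "\<bar>x \<gamma> - x' \<gamma>\<bar> / 2" "1 / 2"] by auto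
      let ?s = "map \<gamma> [0..<n]"
      have "\<bar>x \<gamma> - y ?s \<gamma>\<bar> \<le> 1 / 2 ^ length ?s" "\<bar>x' \<gamma> - y ?s \<gamma>\<bar> \<le> 1 / 2 ^ length ?s"
        using xx' cylinder_map_upt[of \<gamma> n] unfolding Z_def by blast+
      then show False
        using n by (simp add: power_one_over)
    qed
    then show "x = x'" ..
  qed
  have topZ: "topspace (subtopology P Z) = Z"
    using ZP by auto
  \<comment> \<open>A continuous bijection from a compact to a Hausdorff space is a homeomorphism;
    its inverse \<open>g\<close> recovers \<open>x\<close> continuously from the family.\<close>
  have "homeomorphic_map (subtopology P Z) R snd"
  proof (rule continuous_imp_homeomorphic_map[OF _ compact_space_subtopology[OF Z] R(2)])
    show "continuous_map (subtopology P Z) R snd"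
      unfolding R_def continuous_map_in_subtopology
      using continuous_map_from_subtopology[OF snd] by auto
  qed (use topZ topR inj in auto)
  then obtain g where g: "homeomorphic_maps (subtopology P Z) R snd g"
    by (auto simp: homeomorphic_map_maps)
  then have "homeomorphic_map R (subtopology P Z) g"
    by (simp add: homeomorphic_maps_map)
  then have cg: "continuous_map R (subtopology P Z) g" and img: "g ` topspace R = Z"
    using homeomorphic_imp_continuous_map homeomorphic_imp_surjective_map topZ by metis+
  have fstZ: "fst ` Z = (\<Inter>s. L s)"
  proof
    show "(\<Inter>s. L s) \<subseteq> fst ` Z"
    proof
      fix x
      assume x: "x \<in> (\<Inter>s. L s)"
      \<comment> \<open>The approximations can be chosen independently for each \<open>s\<close>,
        since \<open>Z\<close> links the blocks only through \<open>x\<close>.\<close>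
      then have "\<forall>s. \<exists>y\<in>K s. unif_dist (cylinder s) x y \<le> 1 / 2 ^ length s"
        using assms(3) by (force simp: bracket_def)
      then obtain y where y: "\<And>s. y s \<in> K s"
          "\<And>s. unif_dist (cylinder s) x (y s) \<le> 1 / 2 ^ length s"
        by metis
      have "\<bar>x \<gamma> - y s \<gamma>\<bar> \<le> 1 / 2 ^ length s" if "\<gamma> \<in> cylinder s" for s \<gamma>
      proof -
        have "x \<in> topspace cube" "y s \<in> topspace cube"
          using x LT(1) y(1) compactin_subset_topspace[OF assms(1)] by blast+
        then have "\<bar>x \<gamma> - y s \<gamma>\<bar> \<le> unif_dist (cylinder s) x (y s)"
          using that by (intro unif_dist_upper) (auto simp: topspace_cube)
        with y(2)[of s] show ?thesis
          by linarith
      qed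
      \<comment> \<open>Truncation preserves the estimates, which concern only coordinates in
        \<open>cylinder s\<close>.\<close>
      then have "(x, \<lambda>s. zero_outside (cylinder s) (y s)) \<in> Z"
        using x y(1) by (auto simp: Z_def zero_outside_def)
      then show "x \<in> fst ` Z"
        by force
    qed
  qed (auto simp: Z_def)
  have "continuous_map R cube (fst \<circ> g)"
    using cg continuous_map_compose[OF continuous_map_into_fulltopology[OF cg] fst] by simp
  moreover have "(fst \<circ> g) ` topspace R = (\<Inter>s. L s)"
    by (simp only: image_comp[symmetric] img fstZ)
  ultimately have "continuous_map R (subtopology cube (\<Inter>s. L s)) (fst \<circ> g)"
    by (auto simp: continuous_map_in_subtopology)
  with \<open>RN_compact R\<close> \<open>(fst \<circ> g) ` topspace R = _\<close> show ?thesis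
    by blast
qed

end
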